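(* Let $G$ be a finite group and let $n\geq 3$ be an integer. If exactly $n$ distinct composite numbers occur as conjugacy class sizes of $G$ (that is, $|cs_c(G)|=n$), then at most $n$ distinct prime numbers occur as conjugacy class sizes of $G$ (that is, $|cs_p(G)|\leq n$).
   Context: For a finite group $G$, $cs(G)$ denotes the set of sizes of the conjugacy classes of $G$, i.e. $cs(G)=\{|x^G| : x\in G\}$ where $x^G$ is the conjugacy class of $x$ in $G$ (a set, so each size is counted once). A positive integer is composite if it has at least one positive divisor different from $1$ and itself. $cs_c(G)$ is the subset of $cs(G)$ consisting of the composite numbers in it, and $cs_p(G)$ is the subset of $cs(G)$ consisting of the prime numbers in it, so $cs(G)=\{1\}\cup cs_p(G)\cup cs_c(G)$. *)

theory Defs
  imports "HOL-Algebra.Group_Action" "HOL-Computational_Algebra.Primes"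
begin

definition conj_class :: "('a, 'b) monoid_scheme \<Rightarrow> 'a \<Rightarrow> 'a set" where
  "conj_class G x = {inv\<^bsub>G\<^esub> g \<otimes>\<^bsub>G\<^esub> x \<otimes>\<^bsub>G\<^esub> g | g. g \<in> carrier G}"

definition cs :: "('a, 'b) monoid_scheme \<Rightarrow> nat set" where
  "cs G = {card (conj_class G x) | x. x \<in> carrier G}"

definition composite :: "nat \<Rightarrow> bool" where
  "composite m \<longleftrightarrow> m > 0 \<and> (\<exists>d. d dvd m \<and> d \<noteq> 1 \<and> d \<noteq> m)"

definition cs_c :: "('a, 'b) monoid_scheme \<Rightarrow> nat set" where
  "cs_c G = {m \<in> cs G. composite m}"

definition cs_p :: "('a, 'b) monoid_scheme \<Rightarrow> nat set" where
  "cs_p G = {m \<in> cs G. prime m}"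

end

theory Submission
  imports Defs "HOL-Algebra.Generated_Groups"
begin

text \<open>
  Write \<open>x\<^sup>G\<close> for the conjugacy class of \<open>x\<close>. If \<open>x\<^sup>G\<close> and \<open>y\<^sup>G\<close> have coprime sizes, then every
  pair in \<open>x\<^sup>G \<times> y\<^sup>G\<close> is conjugate to \<open>(x, y)\<close>, so \<open>x\<^sup>G y\<^sup>G = (x y)\<^sup>G\<close> and the size of this
  class divides the product of the two sizes. Products of elements of prime class size
  are therefore the natural source of composite class sizes.

  Take distinct prime class sizes \<open>p < q\<close>, realised by \<open>x\<close> and \<open>y\<close>. The size of \<open>(x y)\<^sup>G\<close>
  divides \<open>p q\<close> and is at least \<open>q\<close>, so it is \<open>p q\<close> or \<open>q\<close>. In the second case all the
  translates of \<open>y\<^sup>G\<close> by elements of \<open>x\<^sup>G\<close> coincide, so \<open>y\<^sup>G\<close> is invariant under the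
  subgroup \<open>[x, G]\<close> spanned by the \<open>inv x w\<close> with \<open>w\<close> in \<open>x\<^sup>G\<close>. Its order divides \<open>q\<close>, so it is
  \<open>q\<close>; then \<open>y\<^sup>G\<close> is a single coset of it, and \<open>[y, G]\<close> has order \<open>q\<close> as well
  (\<open>prime_classes_mult\<close>). Thus, with \<open>c p\<close> the order of \<open>[x, G]\<close> for a chosen \<open>x\<close> of class size
  \<open>p\<close>, a pair \<open>p < q\<close> whose product is not a class size satisfies \<open>c p = c q = q\<close>.

  Suppose there are \<open>k \<ge> 4\<close> prime class sizes. Call a pair missing if its product is not
  a class size. A missing pair is determined by its smaller member \<open>p\<close>, the larger one
  being \<open>c p\<close>, and the larger member of a missing pair is never the smaller member of another. So at
  most \<open>k - 1\<close> pairs are missing, and if at most \<open>k - 2\<close> are, then at least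
  \<open>k (k - 1) / 2 - (k - 2) \<ge> k\<close> products of two primes are class sizes. If exactly \<open>k - 1\<close>
  pairs are missing, they all share their larger member \<open>s\<close>, and the bound falls short by
  one. The additional composite size is \<open>p q r\<close>, for any three of the other primes
  (\<open>three_prime_classes_mult\<close>). Hence at least \<open>k\<close> composite numbers are class sizes
  (\<open>card_primes_le_card_products\<close>). At most three prime class sizes are no
  obstacle, because \<open>n \<ge> 3\<close>.
\<close>

definition centralizer :: "('a, 'b) monoid_scheme \<Rightarrow> 'a \<Rightarrow> 'a set" where
  "centralizer G x = {g \<in> carrier G. g \<otimes>\<^bsub>G\<^esub> x = x \<otimes>\<^bsub>G\<^esub> g}"

text \<open>This is the subgroup \<open>[x, G]\<close>.\<close>

definition commutator_span :: "('a, 'b) monoid_scheme \<Rightarrow> 'a \<Rightarrow> 'a set" where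
  "commutator_span G x = generate G ((\<lambda>w. inv\<^bsub>G\<^esub> x \<otimes>\<^bsub>G\<^esub> w) ` conj_class G x)"

section \<open>Counting with cosets\<close>

text \<open>An orbit-stabilizer count that does not mention an action: the nonempty fibres of \<open>f\<close> are
  exactly the right cosets of \<open>D\<close>.\<close>

lemma (in group) card_image_mult_card_fibre:
  assumes fin: "finite (carrier G)" and D: "subgroup D G"
    and fibre: "\<And>g h. g \<in> carrier G \<Longrightarrow> h \<in> carrier G \<Longrightarrow> f g = f h \<longleftrightarrow> g \<otimes> inv h \<in> D"
  shows "card (f ` carrier G) * card D = order G"
proof -
  have coset: "{g \<in> carrier G. f g = f h} = D #> h" if "h \<in> carrier G" for h
  proof -
    have "g \<in> D #> h \<longleftrightarrow> g \<otimes> inv h \<in> D" if "g \<in> carrier G" for g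
      using subgroup.rcos_module[OF D is_group \<open>h \<in> carrier G\<close> that] .
    moreover have "D #> h \<subseteq> carrier G"
      using D that by (simp add: r_coset_subset_G subgroup.subset)
    ultimately show ?thesis using fibre that by blast
  qed
  have "order G = (\<Sum>y\<in>f ` carrier G. card {g \<in> carrier G. f g = y})"
    unfolding order_def
    using sum.image_gen[OF fin, of "\<lambda>_. 1::nat" f] by simp
  also have "\<dots> = (\<Sum>y\<in>f ` carrier G. card D)"
  proof (rule sum.cong)
    fix y assume "y \<in> f ` carrier G"
    then obtain h where h: "h \<in> carrier G" "y = f h" by blast
    then have "D #> h \<in> rcosets D" by (auto simp: RCOSETS_def)
    then show "card {g \<in> carrier G. f g = y} = card D"
      using coset h D card_rcosets_equal subgroup.subset by metis
  qed simp
  finally show ?thesis by simp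
qed

text \<open>A set closed under multiplication by \<open>B\<close> is a disjoint union of right cosets of \<open>B\<close>.\<close>

lemma (in group) subgroup_card_dvd_if_left_invariant:
  assumes fin: "finite X" and X: "X \<subseteq> carrier G" and B: "subgroup B G"
    and inv: "\<And>b x. b \<in> B \<Longrightarrow> x \<in> X \<Longrightarrow> b \<otimes> x \<in> X"
  shows "card B dvd card X"
proof -
  let ?C = "(\<lambda>x. B #> x) ` X"
  have sub: "?C \<subseteq> rcosets B" using X by (auto simp: RCOSETS_def)
  have un: "\<Union>?C = X"
  proof
    show "\<Union>?C \<subseteq> X" using inv by (auto simp: r_coset_def)
    show "X \<subseteq> \<Union>?C" using X rcos_self[OF _ B] by blast
  qed
  have "card B * card ?C = card (\<Union>?C)"
  proof (rule card_partition)
    show "finite ?C" using fin by simp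
    show "finite (\<Union>?C)" unfolding un by (rule fin)
    show "card c = card B" if "c \<in> ?C" for c
      using card_rcosets_equal[OF subsetD[OF sub that] subgroup.subset[OF B]] by simp
    show "c \<inter> d = {}" if "c \<in> ?C" "d \<in> ?C" "c \<noteq> d" for c d
      using pairwiseD[OF rcos_disjoint[OF B] subsetD[OF sub that(1)] subsetD[OF sub that(2)] that(3)]
      by (simp only: disjnt_def)
  qed
  then have "card X = card B * card ?C" by (simp only: un)
  then show ?thesis by (rule dvdI)
qed

section \<open>Centralizers and conjugacy classes\<close>

lemma conj_class_eq_image:
  "conj_class G x = (\<lambda>g. inv\<^bsub>G\<^esub> g \<otimes>\<^bsub>G\<^esub> x \<otimes>\<^bsub>G\<^esub> g) ` carrier G"
  by (auto simp: conj_class_def)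

lemma (in group) conj_class_subset: "x \<in> carrier G \<Longrightarrow> conj_class G x \<subseteq> carrier G"
  by (auto simp: conj_class_def)

lemma (in group) conj_class_self:
  assumes "x \<in> carrier G" shows "x \<in> conj_class G x"
proof -
  have "x = inv \<one> \<otimes> x \<otimes> \<one>" using assms by simp
  then show ?thesis unfolding conj_class_def by blast
qed

lemma (in group) finite_conj_class: "finite (carrier G) \<Longrightarrow> finite (conj_class G x)"
  by (simp add: conj_class_eq_image)

lemma (in group) centralizer_subgroup:
  assumes x: "x \<in> carrier G" shows "subgroup (centralizer G x) G"
proof (rule subgroupI)
  show "centralizer G x \<noteq> {}" using x by (auto simp: centralizer_def intro!: exI[of _ \<one>])
  fix a assume a: "a \<in> centralizer G x"
  then have ac: "a \<in> carrier G" "a \<otimes> x = x \<otimes> a" by (auto simp: centralizer_def)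
  have "inv a \<otimes> x = inv a \<otimes> (x \<otimes> a) \<otimes> inv a" using ac(1) x by (simp add: m_assoc)
  also have "\<dots> = inv a \<otimes> (a \<otimes> x) \<otimes> inv a" by (simp add: ac(2))
  also have "\<dots> = x \<otimes> inv a" using ac(1) x by (simp add: m_assoc[symmetric])
  finally show "inv a \<in> centralizer G x" using ac(1) by (simp add: centralizer_def)
next
  fix a b assume "a \<in> centralizer G x" "b \<in> centralizer G x"
  then show "a \<otimes> b \<in> centralizer G x"
    using x by (auto simp: centralizer_def) (metis m_assoc)
qed (auto simp: centralizer_def)

lemma (in group) conjugates_eq_iff:
  assumes g: "g \<in> carrier G" and h: "h \<in> carrier G" and x: "x \<in> carrier G"
  shows "inv g \<otimes> x \<otimes> g = inv h \<otimes> x \<otimes> h \<longleftrightarrow> g \<otimes> inv h \<in> centralizer G x"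
proof -
  have "inv g \<otimes> x \<otimes> g = inv h \<otimes> x \<otimes> h \<longleftrightarrow> x \<otimes> g = g \<otimes> (inv h \<otimes> x \<otimes> h)"
    using assms by (metis inv_closed inv_solve_left m_assoc m_closed)
  also have "\<dots> \<longleftrightarrow> x \<otimes> g = (g \<otimes> inv h \<otimes> x) \<otimes> h"
    using assms by (simp add: m_assoc)
  also have "\<dots> \<longleftrightarrow> x \<otimes> g \<otimes> inv h = g \<otimes> inv h \<otimes> x"
    using assms by (metis inv_closed inv_solve_right m_closed)
  also have "\<dots> \<longleftrightarrow> g \<otimes> inv h \<otimes> x = x \<otimes> (g \<otimes> inv h)"
    using assms by (simp only: m_assoc inv_closed m_closed) (rule eq_commute)
  finally show ?thesis using g h by (simp add: centralizer_def)
qed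

lemma (in group) card_conj_class_mult_card_centralizer:
  assumes "finite (carrier G)" "x \<in> carrier G"
  shows "card (conj_class G x) * card (centralizer G x) = order G"
  unfolding conj_class_eq_image
  using assms by (intro card_image_mult_card_fibre centralizer_subgroup conjugates_eq_iff)

text \<open>Conjugating \<open>b a\<close> by \<open>b\<close> gives \<open>a b\<close>.\<close>

lemma (in group) conj_class_mult_commute:
  assumes u: "u \<in> carrier G" and v: "v \<in> carrier G"
  shows "conj_class G (u \<otimes> v) = conj_class G (v \<otimes> u)"
proof -
  have sub: "conj_class G (a \<otimes> b) \<subseteq> conj_class G (b \<otimes> a)"
    if a: "a \<in> carrier G" and b: "b \<in> carrier G" for a b
  proof
    fix w assume "w \<in> conj_class G (a \<otimes> b)"
    then obtain g where g: "g \<in> carrier G" "w = inv g \<otimes> (a \<otimes> b) \<otimes> g"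
      by (auto simp: conj_class_def)
    have "inv (b \<otimes> g) \<otimes> (b \<otimes> a) \<otimes> (b \<otimes> g) = inv g \<otimes> (inv b \<otimes> b) \<otimes> (a \<otimes> b) \<otimes> g"
      using a b g(1) by (simp only: inv_mult_group m_assoc m_closed inv_closed)
    also have "\<dots> = w" using a b g by simp
    finally have "w = inv (b \<otimes> g) \<otimes> (b \<otimes> a) \<otimes> (b \<otimes> g)" by (rule sym)
    then show "w \<in> conj_class G (b \<otimes> a)" using b g(1) by (auto simp: conj_class_def)
  qed
  show ?thesis using sub u v by blast
qed

section \<open>Classes of coprime sizes\<close>

text \<open>The set of simultaneous conjugates of \<open>(u, v)\<close> has size \<open>|G : D|\<close>, where \<open>D\<close> is the
  intersection of the two centralizers. This index is a multiple of both class sizes, hence of their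
  product, so the set fills the whole product of the classes. As \<open>D\<close> also centralizes
  \<open>u v\<close>, the size of the class of \<open>u v\<close> divides the same index.\<close>

lemma (in group) coprime_classes:
  assumes fin: "finite (carrier G)" and u: "u \<in> carrier G" and v: "v \<in> carrier G"
    and cop: "coprime (card (conj_class G u)) (card (conj_class G v))"
  shows coprime_classes_simultaneous_conjugates:
      "(\<lambda>g. (inv g \<otimes> u \<otimes> g, inv g \<otimes> v \<otimes> g)) ` carrier G = conj_class G u \<times> conj_class G v"
    and coprime_classes_card_dvd:
      "card (conj_class G (u \<otimes> v)) dvd card (conj_class G u) * card (conj_class G v)"
proof -
  let ?f = "\<lambda>g. (inv g \<otimes> u \<otimes> g, inv g \<otimes> v \<otimes> g)"
  let ?D = "centralizer G u \<inter> centralizer G v"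
  let ?N = "card (?f ` carrier G)"
  have D: "subgroup ?D G" using u v by (intro subgroups_Inter_pair centralizer_subgroup)
  have N: "?N * card ?D = order G"
    by (rule card_image_mult_card_fibre[OF fin D]) (simp add: conjugates_eq_iff u v)
  have pos: "order G > 0" using fin by (simp add: order_gt_0_iff_finite)
  have index_dvd: "card (conj_class G x) dvd ?N"
    if x: "x \<in> carrier G" and sub: "?D \<subseteq> centralizer G x" for x
  proof -
    interpret C: group "G\<lparr>carrier := centralizer G x\<rparr>"
      using centralizer_subgroup[OF x] by (rule subgroup_imp_group)
    have "subgroup ?D (G\<lparr>carrier := centralizer G x\<rparr>)"
      using D centralizer_subgroup[OF x] sub subgroup_incl by blast
    from C.lagrange[OF this] have "card ?D dvd order (G\<lparr>carrier := centralizer G x\<rparr>)"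
      by (metis dvd_triv_right)
    then have "card ?D dvd card (centralizer G x)" by (simp add: order_def)
    then obtain k where "card (centralizer G x) = card ?D * k" ..
    then have "card (conj_class G x) * k * card ?D = ?N * card ?D"
      using N card_conj_class_mult_card_centralizer[OF fin x] by (simp add: ac_simps)
    moreover have "card ?D \<noteq> 0"
      using pos unfolding N[symmetric] by (simp only: nat_0_less_mult_iff neq0_conv)
    ultimately have "?N = card (conj_class G x) * k" by simp
    then show ?thesis by simp
  qed
  have sub: "?f ` carrier G \<subseteq> conj_class G u \<times> conj_class G v"
    by (auto simp: conj_class_def)
  have finp: "finite (conj_class G u \<times> conj_class G v)" using fin finite_conj_class by simp
  have "card (conj_class G u) * card (conj_class G v) dvd ?N"
    using cop u v by (intro divides_mult index_dvd) auto
  moreover have "?N > 0" using pos unfolding N[symmetric] by (simp only: nat_0_less_mult_iff)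
  ultimately have "card (conj_class G u \<times> conj_class G v) \<le> ?N"
    by (simp add: card_cartesian_product dvd_imp_le)
  then show img: "?f ` carrier G = conj_class G u \<times> conj_class G v"
    using card_seteq[OF finp sub] by blast
  have "g \<otimes> (u \<otimes> v) = (u \<otimes> v) \<otimes> g"
    if g: "g \<in> carrier G" "g \<otimes> u = u \<otimes> g" "g \<otimes> v = v \<otimes> g" for g
  proof -
    have "g \<otimes> (u \<otimes> v) = u \<otimes> (g \<otimes> v)" using g(1,2) u v by (simp add: m_assoc[symmetric])
    then show ?thesis using g(1,3) u v by (simp add: m_assoc)
  qed
  then have "?D \<subseteq> centralizer G (u \<otimes> v)" by (auto simp: centralizer_def)
  then have "card (conj_class G (u \<otimes> v)) dvd ?N" using u v by (intro index_dvd) auto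
  then show "card (conj_class G (u \<otimes> v)) dvd card (conj_class G u) * card (conj_class G v)"
    by (simp only: img card_cartesian_product)
qed

lemma (in group) coprime_classes_mult_mem:
  assumes fin: "finite (carrier G)" and u: "u \<in> carrier G" and v: "v \<in> carrier G"
    and cop: "coprime (card (conj_class G u)) (card (conj_class G v))"
    and a: "a \<in> conj_class G u" and b: "b \<in> conj_class G v"
  shows "a \<otimes> b \<in> conj_class G (u \<otimes> v)"
proof -
  obtain g where g: "g \<in> carrier G" "a = inv g \<otimes> u \<otimes> g" "b = inv g \<otimes> v \<otimes> g"
  proof -
    have "(a, b) \<in> (\<lambda>g. (inv g \<otimes> u \<otimes> g, inv g \<otimes> v \<otimes> g)) ` carrier G"
      using coprime_classes_simultaneous_conjugates[OF fin u v cop] a b by simp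
    then show ?thesis using that by blast
  qed
  have "a \<otimes> b = inv g \<otimes> u \<otimes> (g \<otimes> inv g) \<otimes> v \<otimes> g"
    using g u v by (simp only: m_assoc m_closed inv_closed)
  also have "\<dots> = inv g \<otimes> (u \<otimes> v) \<otimes> g" using g u v by (simp add: m_assoc)
  finally show ?thesis using g(1) by (auto simp: conj_class_def)
qed

lemma (in group) coprime_classes_card_le:
  assumes fin: "finite (carrier G)" and u: "u \<in> carrier G" and v: "v \<in> carrier G"
    and cop: "coprime (card (conj_class G v)) (card (conj_class G u))"
  shows "card (conj_class G u) \<le> card (conj_class G (v \<otimes> u))"
proof (rule card_inj_on_le)
  show "inj_on (\<lambda>a. v \<otimes> a) (conj_class G u)"
    using inj_on_subset[OF inj_on_cmult[OF v] conj_class_subset[OF u]] .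
  show "(\<lambda>a. v \<otimes> a) ` conj_class G u \<subseteq> conj_class G (v \<otimes> u)"
    using coprime_classes_mult_mem[OF fin v u cop conj_class_self[OF v]] by blast
qed (use fin finite_conj_class in simp)

section \<open>The subgroup spanned by the commutators of an element\<close>

lemma (in group) commutator_span_subgroup:
  assumes "x \<in> carrier G" shows "subgroup (commutator_span G x) G"
  unfolding commutator_span_def
  using assms conj_class_subset[OF assms] by (intro generate_is_subgroup) auto

text \<open>Each translate of the class of \<open>u\<close> by a conjugate \<open>w\<close> of \<open>v\<close> lies in the class of \<open>v u\<close>.
  If that class is no larger than the class of \<open>u\<close>, all these translates are equal to it; comparing the
  translates by \<open>v\<close> and by \<open>w\<close> shows that \<open>inv v w\<close> maps the class of \<open>u\<close> to itself.\<close>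

lemma (in group) commutator_span_left_invariant:
  assumes fin: "finite (carrier G)" and u: "u \<in> carrier G" and v: "v \<in> carrier G"
    and cop: "coprime (card (conj_class G v)) (card (conj_class G u))"
    and eq: "card (conj_class G (v \<otimes> u)) = card (conj_class G u)"
    and b: "b \<in> commutator_span G v" and x: "x \<in> conj_class G u"
  shows "b \<otimes> x \<in> conj_class G u"
proof -
  note clu = subsetD[OF conj_class_subset[OF u]]
  note clv = subsetD[OF conj_class_subset[OF v]]
  have translate: "(\<lambda>a. w \<otimes> a) ` conj_class G u = conj_class G (v \<otimes> u)"
    if w: "w \<in> conj_class G v" for w
  proof (rule card_subset_eq)
    show "finite (conj_class G (v \<otimes> u))" using fin finite_conj_class by simp
    show "(\<lambda>a. w \<otimes> a) ` conj_class G u \<subseteq> conj_class G (v \<otimes> u)"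
      using coprime_classes_mult_mem[OF fin v u cop w] by blast
    have "inj_on (\<lambda>a. w \<otimes> a) (conj_class G u)"
      using clu clv[OF w] by (auto simp: inj_on_def)
    then show "card ((\<lambda>a. w \<otimes> a) ` conj_class G u) = card (conj_class G (v \<otimes> u))"
      by (simp add: card_image eq)
  qed
  have gen: "(inv v \<otimes> w) \<otimes> y \<in> conj_class G u"
    if w: "w \<in> conj_class G v" and y: "y \<in> conj_class G u" for w y
  proof -
    have "w \<otimes> y \<in> (\<lambda>a. v \<otimes> a) ` conj_class G u"
      using translate[OF w] translate[OF conj_class_self[OF v]] y by blast
    then obtain a where a: "a \<in> conj_class G u" "w \<otimes> y = v \<otimes> a" by blast
    have "(inv v \<otimes> w) \<otimes> y = inv v \<otimes> (v \<otimes> a)"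
      using a(2) v clv[OF w] clu[OF y] by (simp add: m_assoc)
    then have "(inv v \<otimes> w) \<otimes> y = a" using clu[OF a(1)] v by (simp add: m_assoc[symmetric])
    then show ?thesis using a(1) by simp
  qed
  \<comment> \<open>By finiteness the generators permute the class, so their inverses preserve it too.\<close>
  have surj: "(\<lambda>y. (inv v \<otimes> w) \<otimes> y) ` conj_class G u = conj_class G u"
    if w: "w \<in> conj_class G v" for w
  proof (rule endo_inj_surj)
    show "finite (conj_class G u)" using fin finite_conj_class by simp
    show "(\<lambda>y. (inv v \<otimes> w) \<otimes> y) ` conj_class G u \<subseteq> conj_class G u" using gen[OF w] by blast
    show "inj_on (\<lambda>y. (inv v \<otimes> w) \<otimes> y) (conj_class G u)"
      using clu clv[OF w] v by (auto simp: inj_on_def)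
  qed
  have "b \<in> generate G ((\<lambda>w. inv v \<otimes> w) ` conj_class G v)"
    using b by (simp add: commutator_span_def)
  then show ?thesis using x
  proof (induction arbitrary: x)
    case one
    then show ?case using clu by simp
  next
    case (incl h)
    then show ?case using gen by blast
  next
    case (inv h)
    then obtain w where w: "w \<in> conj_class G v" "h = inv v \<otimes> w" by blast
    then obtain y where y: "y \<in> conj_class G u" "x = h \<otimes> y" using surj[OF w(1)] inv.prems by blast
    have "h \<in> carrier G" using w clv v by simp
    then have "inv h \<otimes> x = y" using y clu by (simp add: m_assoc[symmetric])
    then show ?case using y(1) by simp
  next
    case (eng h1 h2)
    have "h \<in> carrier G" if "h \<in> generate G ((\<lambda>w. inv v \<otimes> w) ` conj_class G v)" for h
      using that commutator_span_subgroup[OF v] subgroup.mem_carrier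
      unfolding commutator_span_def by metis
    then show ?case using eng clu by (simp add: m_assoc)
  qed
qed

text \<open>The size \<open>m\<close> of the class of \<open>v u\<close> divides the product of the two sizes and is at least the size
  of the class of \<open>u\<close>. If the prime did not divide \<open>m\<close>, then \<open>m\<close> would equal the size of the class of
  \<open>u\<close>, and the invariance of that class under \<open>[v, G]\<close> would contradict the last assumption.\<close>

lemma (in group) prime_class_dvd_card_mult:
  assumes fin: "finite (carrier G)" and u: "u \<in> carrier G" and v: "v \<in> carrier G"
    and cop: "coprime (card (conj_class G v)) (card (conj_class G u))"
    and pr: "prime (card (conj_class G v))"
    and ndvd: "\<not> card (commutator_span G v) dvd card (conj_class G u)"
  shows "card (conj_class G v) dvd card (conj_class G (v \<otimes> u))"
proof (rule ccontr)
  let ?m = "card (conj_class G (v \<otimes> u))"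
  assume "\<not> ?thesis"
  then have "coprime ?m (card (conj_class G v))"
    using pr prime_imp_coprime coprime_commute by blast
  then have "?m dvd card (conj_class G u)"
    using coprime_classes_card_dvd[OF fin v u cop] by (simp add: coprime_dvd_mult_right_iff)
  moreover have "card (conj_class G u) > 0"
    using fin finite_conj_class conj_class_self[OF u] by (auto simp: card_gt_0_iff)
  ultimately have "?m = card (conj_class G u)"
    using coprime_classes_card_le[OF fin u v cop] dvd_imp_le by (simp add: le_antisym)
  then have "card (commutator_span G v) dvd card (conj_class G u)"
    using fin u v cop commutator_span_left_invariant
    by (intro subgroup_card_dvd_if_left_invariant commutator_span_subgroup
        conj_class_subset finite_conj_class) auto
  then show False using ndvd by simp
qed

text \<open>If the class of \<open>x y\<close> does not have the size \<open>p q\<close>, its size is \<open>q\<close>, so the class of \<open>y\<close> is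
  invariant under \<open>B = [x, G]\<close>. Since \<open>B\<close> is nontrivial and its order divides \<open>q\<close>, the class of \<open>y\<close> is
  the coset \<open>B y\<close>. Consequently the elements \<open>inv y w\<close> that generate \<open>[y, G]\<close> already form a
  subgroup of order \<open>q\<close>, namely the conjugate of \<open>B\<close> by \<open>y\<close>.\<close>

lemma (in group) prime_classes_mult:
  assumes fin: "finite (carrier G)" and x: "x \<in> carrier G" and y: "y \<in> carrier G"
    and p: "prime p" and q: "prime q" and pq: "p < q"
    and cx: "card (conj_class G x) = p" and cy: "card (conj_class G y) = q"
    and ne: "card (conj_class G (x \<otimes> y)) \<noteq> p * q"
  shows "card (commutator_span G x) = q" "card (commutator_span G y) = q"
proof -
  let ?m = "card (conj_class G (x \<otimes> y))" and ?B = "commutator_span G x"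
  have "coprime p q" using p q pq by (simp add: primes_coprime)
  then have cop: "coprime (card (conj_class G x)) (card (conj_class G y))"
    by (simp add: cx cy)
  have dvd: "?m dvd p * q" using coprime_classes_card_dvd[OF fin x y cop] by (simp add: cx cy)
  have ge: "q \<le> ?m" using coprime_classes_card_le[OF fin y x cop] by (simp add: cy)
  have ndvd: "\<not> p dvd ?m"
  proof
    assume "p dvd ?m"
    then obtain d where d: "?m = p * d" ..
    then have "d dvd q" using dvd p by (metis dvd_times_left_cancel_iff not_prime_0)
    then have "d = 1 \<or> d = q" using q prime_nat_iff by blast
    then show False using ne d ge pq by auto
  qed
  then have m: "?m dvd q"
    using dvd p prime_imp_coprime[of p ?m] by (simp add: coprime_commute coprime_dvd_mult_right_iff)
  then have eq: "?m = card (conj_class G y)"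
    using ge q cy dvd_imp_le prime_gt_0_nat by (simp add: le_antisym)
  note invar = commutator_span_left_invariant[OF fin y x cop eq]
  have B: "subgroup ?B G" using x by (rule commutator_span_subgroup)
  have "?B \<noteq> {\<one>}"
  proof
    assume triv: "?B = {\<one>}"
    have "conj_class G x \<subseteq> {x}"
    proof
      fix w assume w: "w \<in> conj_class G x"
      then have "inv x \<otimes> w \<in> ?B" by (auto simp: commutator_span_def intro: generate.incl)
      then have "inv x \<otimes> w = \<one>" using triv by simp
      then show "w \<in> {x}" using x w conj_class_subset[OF x]
        by (metis inv_closed inv_equality inv_inv singletonI subsetD inv_comm)
    qed
    then have "card (conj_class G x) \<le> 1" using card_mono[of "{x}"] by simp
    then show False using prime_gt_1_nat[OF p] by (simp add: cx)
  qed
  then have "card ?B \<noteq> 1"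
    using subgroup.one_closed[OF B] by (auto simp: card_1_singleton_iff)
  moreover have "card ?B dvd q"
    using subgroup_card_dvd_if_left_invariant[OF finite_conj_class[OF fin] conj_class_subset[OF y] B invar]
    by (simp add: cy)
  ultimately show cB: "card ?B = q" using q prime_nat_iff by blast
  have coset: "(\<lambda>b. b \<otimes> y) ` ?B = conj_class G y"
  proof (rule card_subset_eq)
    show "finite (conj_class G y)" using fin by (rule finite_conj_class)
    show "(\<lambda>b. b \<otimes> y) ` ?B \<subseteq> conj_class G y" using invar conj_class_self[OF y] by blast
    have "inj_on (\<lambda>b. b \<otimes> y) ?B" using inj_on_subset[OF inj_on_multc[OF y] subgroup.subset[OF B]] .
    then show "card ((\<lambda>b. b \<otimes> y) ` ?B) = card (conj_class G y)"
      by (simp add: card_image cB cy)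
  qed
  let ?K = "(\<lambda>b. inv y \<otimes> (b \<otimes> y)) ` ?B"
  note Bcl = subgroup.mem_carrier[OF B]
  have K: "subgroup ?K G"
  proof (rule subgroupI)
    show "?K \<subseteq> carrier G" using Bcl y by auto
    show "?K \<noteq> {}" using subgroup.one_closed[OF B] by blast
    fix a assume "a \<in> ?K"
    then obtain b where b: "b \<in> ?B" "a = inv y \<otimes> (b \<otimes> y)" by blast
    have "inv a = inv y \<otimes> (inv b \<otimes> y)"
      using b Bcl[OF b(1)] y by (simp add: inv_mult_group m_assoc)
    then show "inv a \<in> ?K" using b subgroup.m_inv_closed[OF B] by blast
  next
    fix a a' assume "a \<in> ?K" "a' \<in> ?K"
    then obtain b b' where b: "b \<in> ?B" "a = inv y \<otimes> (b \<otimes> y)" "b' \<in> ?B" "a' = inv y \<otimes> (b' \<otimes> y)"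
      by blast
    have "a \<otimes> a' = inv y \<otimes> (b \<otimes> (y \<otimes> inv y) \<otimes> b' \<otimes> y)"
      using b Bcl y by (simp only: m_assoc m_closed inv_closed)
    then have "a \<otimes> a' = inv y \<otimes> ((b \<otimes> b') \<otimes> y)" using b Bcl y by simp
    then show "a \<otimes> a' \<in> ?K" using b subgroup.m_closed[OF B] by blast
  qed
  have "(\<lambda>w. inv y \<otimes> w) ` conj_class G y = ?K" unfolding coset[symmetric] by (simp add: image_image)
  then have "commutator_span G y = generate G ?K" by (simp only: commutator_span_def)
  also have "\<dots> = ?K"
    using generate_subgroup_incl[OF order_refl K] by (blast intro: generate.incl)
  finally have "commutator_span G y = ?K" .
  moreover have "inj_on (\<lambda>b. inv y \<otimes> (b \<otimes> y)) ?B"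
    using Bcl y by (intro inj_onI) simp
  ultimately show "card (commutator_span G y) = q" by (simp add: card_image cB)
qed

text \<open>If the class of \<open>x y\<close> had a different size, the common order \<open>s\<close> would be the
  larger of \<open>p\<close> and \<open>q\<close>.\<close>

lemma (in group) prime_classes_mult_common_span:
  assumes fin: "finite (carrier G)" and x: "x \<in> carrier G" and y: "y \<in> carrier G"
    and p: "prime p" and q: "prime q" and "p \<noteq> q"
    and cx: "card (conj_class G x) = p" and cy: "card (conj_class G y) = q"
    and sx: "card (commutator_span G x) = s" and sy: "card (commutator_span G y) = s"
    and s: "s \<noteq> p" "s \<noteq> q"
  shows "card (conj_class G (x \<otimes> y)) = p * q"
proof (cases "p < q")
  case True
  then show ?thesis using prime_classes_mult(1)[OF fin x y p q _ cx cy] sx s by blast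
next
  case False
  then have "q < p" using \<open>p \<noteq> q\<close> by simp
  then have "card (conj_class G (y \<otimes> x)) = q * p"
    using prime_classes_mult(1)[OF fin y x q p _ cy cx] sy s by blast
  then show ?thesis by (simp add: conj_class_mult_commute[OF x y] mult.commute)
qed

text \<open>The products of two of the three elements have class sizes \<open>p q\<close>, \<open>q r\<close> and \<open>r p\<close>, none of which
  is divisible by \<open>s\<close>. So each of the primes divides the size of the class of \<open>x y z\<close>: the three
  cyclic rearrangements of the product are conjugate, and each of the elements comes first in one of
  them.\<close>

lemma (in group) three_prime_classes_mult:
  assumes fin: "finite (carrier G)"
    and x: "x \<in> carrier G" and y: "y \<in> carrier G" and z: "z \<in> carrier G"
    and p: "prime p" and q: "prime q" and r: "prime r" and s: "prime s"
    and dist: "p \<noteq> q" "p \<noteq> r" "q \<noteq> r" "s \<notin> {p, q, r}"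
    and cx: "card (conj_class G x) = p" and cy: "card (conj_class G y) = q"
    and cz: "card (conj_class G z) = r"
    and sx: "card (commutator_span G x) = s" and sy: "card (commutator_span G y) = s"
    and sz: "card (commutator_span G z) = s"
  shows "card (conj_class G (x \<otimes> (y \<otimes> z))) = p * q * r"
proof -
  let ?m = "card (conj_class G (x \<otimes> (y \<otimes> z)))"
  have cxy: "card (conj_class G (x \<otimes> y)) = p * q"
    using prime_classes_mult_common_span[OF fin x y p q _ cx cy sx sy] dist by simp
  have cyz: "card (conj_class G (y \<otimes> z)) = q * r"
    using prime_classes_mult_common_span[OF fin y z q r _ cy cz sy sz] dist by simp
  have czx: "card (conj_class G (z \<otimes> x)) = r * p"
    using prime_classes_mult_common_span[OF fin z x r p _ cz cx sz sx] dist by simp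
  have nd: "\<not> s dvd q * r" "\<not> s dvd r * p" "\<not> s dvd p * q"
    using p q r s dist by (auto simp: prime_dvd_mult_iff primes_dvd_imp_eq)
  have cop: "coprime p q" "coprime p r" "coprime q r" "coprime q p" "coprime r p" "coprime r q"
    using p q r dist by (auto simp: primes_coprime)
  have rot1: "conj_class G (y \<otimes> (z \<otimes> x)) = conj_class G (x \<otimes> (y \<otimes> z))"
    using conj_class_mult_commute[of x "y \<otimes> z"] x y z by (simp add: m_assoc)
  have rot2: "conj_class G (z \<otimes> (x \<otimes> y)) = conj_class G (x \<otimes> (y \<otimes> z))"
    using conj_class_mult_commute[of "x \<otimes> y" z] x y z by (simp add: m_assoc)
  have "p dvd ?m"
    using prime_class_dvd_card_mult[OF fin _ x, of "y \<otimes> z"] y z cop p nd by (simp add: cx cyz sx)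
  moreover have "q dvd ?m"
    using prime_class_dvd_card_mult[OF fin _ y, of "z \<otimes> x"] z x cop q nd
    by (simp add: cy czx rot1 sy)
  moreover have "r dvd ?m"
    using prime_class_dvd_card_mult[OF fin _ z, of "x \<otimes> y"] x y cop r nd
    by (simp add: cz cxy rot2 sz)
  ultimately have "p * q * r dvd ?m" using cop by (simp add: divides_mult)
  moreover have "?m dvd p * q * r"
    using coprime_classes_card_dvd[OF fin x, of "y \<otimes> z"] y z cop by (simp add: cx cyz mult.assoc)
  ultimately show ?thesis by (rule dvd_antisym[rotated])
qed

section \<open>Counting products of primes\<close>

text \<open>By unique factorization, the members of a set of primes are the prime divisors of its product.\<close>

lemma inj_on_prod_prime_sets:
  fixes S :: "nat set"
  assumes fin: "finite S" and pr: "\<And>p. p \<in> S \<Longrightarrow> prime p"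
  shows "inj_on (\<lambda>B. \<Prod>B) (Pow S)"
proof (rule inj_onI)
  have mem: "p \<in> B \<longleftrightarrow> prime p \<and> p dvd \<Prod>B" if B: "B \<subseteq> S" for p B
  proof -
    have finB: "finite B" using B fin finite_subset by blast
    have "p \<in> B" if p: "prime p" "p dvd \<Prod>B"
    proof -
      obtain b where "b \<in> B" "p dvd b" using p(2) unfolding prime_dvd_prod_iff[OF finB p(1)] by blast
      then show ?thesis using \<open>prime p\<close> B pr primes_dvd_imp_eq by blast
    qed
    then show ?thesis using finB B pr by (auto intro: dvd_prodI)
  qed
  fix A B assume "A \<in> Pow S" "B \<in> Pow S" "\<Prod>A = \<Prod>B"
  then show "A = B" using mem by (auto simp: set_eq_iff)
qed

text \<open>The arithmetic of the argument, with \<open>C\<close> for the composite class sizes and \<open>c p\<close> for the order of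
  \<open>[x, G]\<close>, where \<open>x\<close> has class size \<open>p\<close>. A pair of primes is a two-element set, so that products of two
  and of three primes are covered by the same injectivity statement.\<close>

lemma card_primes_le_card_products:
  fixes S C :: "nat set" and c :: "nat \<Rightarrow> nat"
  assumes finS: "finite S" and finC: "finite C" and pr: "\<And>p. p \<in> S \<Longrightarrow> prime p"
    and four: "4 \<le> card S"
    and pair: "\<And>p q. p \<in> S \<Longrightarrow> q \<in> S \<Longrightarrow> p < q \<Longrightarrow> p * q \<notin> C \<Longrightarrow> c p = q \<and> c q = q"
    and triple: "\<And>p q r s. {p, q, r, s} \<subseteq> S \<Longrightarrow> p \<noteq> q \<Longrightarrow> p \<noteq> r \<Longrightarrow> q \<noteq> r \<Longrightarrow> s \<notin> {p, q, r} \<Longrightarrow>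
        c p = s \<Longrightarrow> c q = s \<Longrightarrow> c r = s \<Longrightarrow> p * q * r \<in> C"
  shows "card S \<le> card C"
proof -
  let ?k = "card S"
  \<comment> \<open>\<open>P\<close> holds all pairs, \<open>M\<close> the missing ones and \<open>T\<close> their smaller members.\<close>
  define P where "P = {B. B \<subseteq> S \<and> card B = 2}"
  define M where "M = {B \<in> P. \<Prod>B \<notin> C}"
  define T where "T = Min ` M"
  have finP: "finite P" unfolding P_def using finS by simp
  have cardP: "card P = ?k choose 2" unfolding P_def using finS by (rule n_subsets)
  have M: "\<exists>p q. B = {p, q} \<and> p \<in> S \<and> q \<in> S \<and> p < q \<and> Min B = p \<and> c p = q \<and> c q = q"
    if B: "B \<in> M" for B
  proof -
    obtain a b where ab: "B = {a, b}" "a \<noteq> b"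
      using B unfolding M_def P_def card_2_iff by blast
    obtain p q where pq: "B = {p, q}" "p < q"
      using ab by (metis insert_commute linorder_neqE_nat)
    have "p \<in> S" "q \<in> S" "p * q \<notin> C" using B pq unfolding M_def P_def by auto
    then show ?thesis using pair[of p q] pq by auto
  qed
  have "inj_on Min M"
  proof (rule inj_onI)
    fix A B assume "A \<in> M" "B \<in> M" "Min A = Min B"
    then show "A = B" using M[of A] M[of B] by auto
  qed
  then have cardT: "card T = card M" unfolding T_def by (rule card_image)
  have T: "p \<in> S \<and> c p \<in> S \<and> c p \<notin> T" if "p \<in> T" for p
  proof -
    have 1: "p \<in> S \<and> p < c p \<and> c p \<in> S \<and> c (c p) = c p" if "p \<in> T" for p
      using that M unfolding T_def by fastforce
    then show ?thesis using that 1[of "c p"] by auto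
  qed
  have TS: "T \<subseteq> S" using T by blast
  have finT: "finite T" using TS finS finite_subset by blast
  have MP: "M \<subseteq> P" unfolding M_def by blast
  have img: "(\<lambda>B. \<Prod>B) ` (P - M) \<subseteq> C" unfolding M_def by auto
  have inj: "inj_on (\<lambda>B. \<Prod>B) (Pow S)" using inj_on_prod_prime_sets finS pr .
  have "inj_on (\<lambda>B. \<Prod>B) (P - M)" by (rule inj_on_subset[OF inj]) (auto simp: P_def)
  then have "card ((\<lambda>B. \<Prod>B) ` (P - M)) = card (P - M)" by (rule card_image)
  then have cimg: "card ((\<lambda>B. \<Prod>B) ` (P - M)) = (?k choose 2) - card T"
    using card_Diff_subset[OF finite_subset[OF MP finP] MP] by (simp add: cardP cardT)
  \<comment> \<open>Equivalent to \<open>(k - 1) (k - 4) \<ge> 0\<close>; this is where four primes are needed.\<close>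
  have numeric: "2 * ?k \<le> (?k choose 2) + 2"
  proof -
    obtain j where j: "?k = j + 4" using four by (metis add.commute le_Suc_ex)
    have "even (?k * (?k - 1))" by auto
    then have "2 * (?k choose 2) = ?k * (?k - 1)" unfolding choose_two by simp
    then have "2 * (?k choose 2) = (j + 4) * (j + 3)" by (simp add: j)
    then show ?thesis unfolding j by (simp add: algebra_simps)
  qed
  have "T \<noteq> S" using T four by (metis card.empty equals0I not_numeral_le_zero)
  then have "T \<subset> S" using TS by blast
  then have ltT: "card T < ?k" using finS psubset_card_mono by blast
  show ?thesis
  proof (cases "card T + 2 \<le> ?k")
    case True
    then have "?k \<le> (?k choose 2) - card T" using numeric by linarith
    then show ?thesis using cimg card_mono[OF finC img] by linarith
  next
    case False
    \<comment> \<open>Every prime but one, \<open>s\<close>, is the smaller member of a missing pair, whose larger member must be \<open>s\<close>.\<close>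
    then have cT: "card T = ?k - 1" using ltT by linarith
    then have "card (S - T) = 1" using card_Diff_subset[OF finT TS] four by simp
    then obtain s where s: "S - T = {s}" by (auto simp: card_1_singleton_iff)
    have cs: "c p = s" if "p \<in> T" for p using T[OF that] s by blast
    have sS: "s \<in> S" "s \<notin> T" using s by auto
    have "3 \<le> card T" using cT four by linarith
    then obtain U where U: "U \<subseteq> T" "card U = 3" using obtain_subset_with_card_n by blast
    then obtain p q r where U3: "U = {p, q, r}" "p \<noteq> q" "p \<noteq> r" "q \<noteq> r"
      by (auto simp: card_3_iff)
    then have pqr: "p \<in> T" "q \<in> T" "r \<in> T" using U by auto
    have "p * q * r \<in> C"
      using pqr U3 TS sS cs by (intro triple[of p q r s]) auto
    then have UC: "\<Prod>U \<in> C" using U3 by (simp add: mult.assoc)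
    have "\<Prod>U \<notin> (\<lambda>B. \<Prod>B) ` (P - M)"
    proof
      assume "\<Prod>U \<in> (\<lambda>B. \<Prod>B) ` (P - M)"
      then obtain B where B: "B \<in> P" "\<Prod>U = \<Prod>B" by blast
      then have "U = B" using inj U TS unfolding inj_on_def P_def by blast
      then show False using B U unfolding P_def by simp
    qed
    then have "card (insert (\<Prod>U) ((\<lambda>B. \<Prod>B) ` (P - M))) = Suc ((?k choose 2) - card T)"
      using cimg finP by simp
    moreover have "card (insert (\<Prod>U) ((\<lambda>B. \<Prod>B) ` (P - M))) \<le> card C"
      using card_mono[OF finC] img UC by simp
    ultimately show ?thesis using numeric cT four by linarith
  qed
qed

theorem theorem1:
  fixes G :: "('a, 'b) monoid_scheme" and n :: nat
  assumes "group G" and "finite (carrier G)"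
    and "n \<ge> 3"
    and "card (cs_c G) = n"
  shows "card (cs_p G) \<le> n"
proof (cases "card (cs_p G) \<le> 3")
  case True
  then show ?thesis using assms(3) by linarith
next
  case False
  interpret group G by fact
  have fin: "finite (carrier G)" by fact
  have "finite (cs G)" unfolding cs_def using fin by simp
  then have finp: "finite (cs_p G)" and finc: "finite (cs_c G)" by (auto simp: cs_p_def cs_c_def)
  have "\<forall>p\<in>cs_p G. \<exists>x. x \<in> carrier G \<and> card (conj_class G x) = p"
    by (auto simp: cs_p_def cs_def)
  then obtain x where x: "\<And>p. p \<in> cs_p G \<Longrightarrow> x p \<in> carrier G"
    and cx: "\<And>p. p \<in> cs_p G \<Longrightarrow> card (conj_class G (x p)) = p"
    by metis
  have pr: "prime p" if "p \<in> cs_p G" for p using that by (simp add: cs_p_def)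
  have mem: "card (conj_class G y) \<in> cs_c G"
    if "y \<in> carrier G" "card (conj_class G y) = p * m" "p \<in> cs_p G" "m > 1" for y p m
  proof -
    have "p > 1" using pr that prime_gt_1_nat by blast
    then have "composite (p * m)"
      unfolding composite_def using that(4) by (intro conjI exI[of _ p]) auto
    moreover have "p * m \<in> cs G" unfolding cs_def using that(1) that(2)[symmetric] by blast
    ultimately show ?thesis by (simp add: cs_c_def that(2))
  qed
  let ?c = "\<lambda>p. card (commutator_span G (x p))"
  have "card (cs_p G) \<le> card (cs_c G)"
  proof (rule card_primes_le_card_products[OF finp finc pr, where c = ?c])
    show "4 \<le> card (cs_p G)" using False by linarith
  next
    fix p q assume pq: "p \<in> cs_p G" "q \<in> cs_p G" "p < q" and "p * q \<notin> cs_c G"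
    moreover have "q > 1" using pr[OF pq(2)] by (rule prime_gt_1_nat)
    ultimately have "card (conj_class G (x p \<otimes>\<^bsub>G\<^esub> x q)) \<noteq> p * q"
      using mem[of "x p \<otimes>\<^bsub>G\<^esub> x q" p q] x by auto
    then show "?c p = q \<and> ?c q = q"
      using prime_classes_mult[OF fin x x pr pr _ cx cx] pq by blast
  next
    fix p q r s
    assume S: "{p, q, r, s} \<subseteq> cs_p G" and "p \<noteq> q" "p \<noteq> r" "q \<noteq> r" "s \<notin> {p, q, r}"
      and "?c p = s" "?c q = s" "?c r = s"
    then have eq: "card (conj_class G (x p \<otimes>\<^bsub>G\<^esub> (x q \<otimes>\<^bsub>G\<^esub> x r))) = p * q * r"
      using x pr cx by (intro three_prime_classes_mult[OF fin, where s = s]) auto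
    have "q > 1" "r > 1" using S pr prime_gt_1_nat by auto
    then have "q * r > 1" by (rule less_1_mult)
    then show "p * q * r \<in> cs_c G"
      using mem[of "x p \<otimes>\<^bsub>G\<^esub> (x q \<otimes>\<^bsub>G\<^esub> x r)" p "q * r"] eq S x by (auto simp: mult.assoc)
  qed
  then show ?thesis using assms(4) by simp
qed

end
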